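(* For all integers $2 \le s \le t$, $$\pi_{\vec{K}_{s,t}}(\emptyset) = \binom{s+t}{s} \left(\frac{s}{s+t}\right)^s \left(\frac{t}{s+t}\right)^t,$$ and this value is achieved asymptotically by the balanced blow-up of $\vec{K}_{s,t}$: the induced density of $\vec{K}_{s,t}$ in the $n$-vertex complete bipartite digraph $\vec{K}_{\frac{s}{s+t}n,\frac{t}{s+t}n}$ converges to $\pi_{\vec{K}_{s,t}}(\emptyset)$ as $n\to\infty$.
   Context: Directed graphs (digraphs) are finite, without loops, and between any two distinct vertices there is at most one directed edge. For positive integers $a,b$, the complete bipartite digraph $\vec{K}_{a,b}$ has vertex set $[a+b]=\{1,\dots,a+b\}$ and edge set consisting of the edges oriented from $i$ to $a+j$ for every $1\le i\le a$, $1\le j\le b$ (and no other edges). In $\vec{K}_{\frac{s}{s+t}n,\frac{t}{s+t}n}$ the part sizes are understood to be rounded to integers summing to $n$ (e.g. $\lfloor \frac{s}{s+t}n\rfloor$ and $n-\lfloor \frac{s}{s+t}n\rfloor$). For a digraph $H$ on $h$ vertices and a digraph $D$ on $n\ge h$ vertices, the number of induced copies of $H$ in $D$ is the number of $h$-element subsets of $V(D)$ which induce a subdigraph isomorphic to $H$, and the induced density of $H$ in $D$ is this number divided by $\binom{n}{h}$. The inducibility $\pi_H(\emptyset)$ is the limit, as $n\to\infty$, of the maximum induced density of $H$ over all $n$-vertex digraphs. *)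

theory Defs
  imports
    Complex_Main
    Graph_Theory.Pair_Digraph
    Graph_Theory.Digraph_Component
    Graph_Theory.Digraph_Isomorphism
begin

(* pair_digraph already requires finiteness and forbids loops, but allows 2-cycles. *)
locale pair_oriented_digraph = pair_digraph +
  assumes no_opposite_arcs: "(u, v) \<in> parcs G \<Longrightarrow> (v, u) \<notin> parcs G"

definition complete_bipartite_digraph :: "nat \<Rightarrow> nat \<Rightarrow> nat pair_pre_digraph" where
  "complete_bipartite_digraph a b =
     \<lparr> pverts = {1..a + b}, parcs = {(i, a + j) | i j. i \<in> {1..a} \<and> j \<in> {1..b}} \<rparr>"

definition induced_copies :: "'a pair_pre_digraph \<Rightarrow> 'b pair_pre_digraph \<Rightarrow> nat" where
  "induced_copies H D =
     card {S. S \<subseteq> pverts D \<and> card S = card (pverts H) \<and>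
              digraph_iso (induce_subgraph (with_proj D) S) (with_proj H)}"

(* Only meaningful if D has at least as many vertices as H; otherwise the value is 0 / 0 = 0. *)
definition induced_density :: "'a pair_pre_digraph \<Rightarrow> 'b pair_pre_digraph \<Rightarrow> real" where
  "induced_density H D =
     real (induced_copies H D) / real (card (pverts D) choose card (pverts H))"

(* Every finite digraph is isomorphic to one whose vertices are natural numbers, so it is enough
   to let D range over those. The maximum exists by the two lemmas below. *)
definition max_induced_density :: "'a pair_pre_digraph \<Rightarrow> nat \<Rightarrow> real" where
  "max_induced_density H n =
     Max {induced_density H D | D :: nat pair_pre_digraph.
            pair_oriented_digraph D \<and> card (pverts D) = n}"

definition inducibility :: "'a pair_pre_digraph \<Rightarrow> real" where
  "inducibility H = lim (max_induced_density H)"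

lemma pair_oriented_complete_bipartite_digraph:
  "pair_oriented_digraph (complete_bipartite_digraph a b)"
proof -
  have "parcs (complete_bipartite_digraph a b) \<subseteq> {1..a} \<times> {1..a + b}"
    by (auto simp: complete_bipartite_digraph_def)
  then have "finite (parcs (complete_bipartite_digraph a b))"
    by (rule finite_subset) simp
  then show ?thesis
    by unfold_locales (auto simp: complete_bipartite_digraph_def)
qed

lemma finite_induced_densities:
  "finite {induced_density H D | D :: nat pair_pre_digraph.
             pair_oriented_digraph D \<and> card (pverts D) = n}"
proof (rule finite_subset)
  let ?h = "card (pverts H)"
  show "{induced_density H D | D :: nat pair_pre_digraph.
           pair_oriented_digraph D \<and> card (pverts D) = n}
        \<subseteq> (\<lambda>k. real k / real (n choose ?h)) ` {0..n choose ?h}"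
  proof clarify
    fix D :: "nat pair_pre_digraph"
    assume D: "pair_oriented_digraph D" and n: "n = card (pverts D)"
    interpret pair_oriented_digraph D by (fact D)
    have "induced_copies H D \<le> card {S. S \<subseteq> pverts D \<and> card S = ?h}"
      unfolding induced_copies_def
      by (rule card_mono, rule finite_subset[of _ "Pow (pverts D)"]) (auto simp: pair_finite_verts)
    also have "\<dots> = (card (pverts D) choose ?h)"
      by (rule n_subsets) (rule pair_finite_verts)
    finally show "induced_density H D \<in>
        (\<lambda>k. real k / real (card (pverts D) choose ?h)) ` {0..card (pverts D) choose ?h}"
      by (auto simp: induced_density_def)
  qed
qed simp

lemma induced_densities_nonempty:
  "{induced_density H D | D :: nat pair_pre_digraph.
      pair_oriented_digraph D \<and> card (pverts D) = n} \<noteq> {}"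
proof -
  have "card (pverts (complete_bipartite_digraph 0 n)) = n"
    by (simp add: complete_bipartite_digraph_def)
  with pair_oriented_complete_bipartite_digraph[of 0 n] show ?thesis by blast
qed

end

theory Submission
  imports Defs "HOL-Library.FuncSet" "HOL-Combinatorics.Permutations"
begin

text \<open>
  Write \<open>K\<close> for the complete bipartite digraph with parts of sizes \<open>s\<close> and \<open>t\<close>. The lower bound
  is a count: one part of size about \<open>s n / (s + t)\<close> and the rest of the \<open>n\<close> vertices give
  \<open>(a choose s) * (b choose t)\<close> induced copies. The upper bound is a Motzkin--Straus argument.

  Give the vertices of an oriented digraph \<open>D\<close> nonnegative weights of total \<open>1\<close> and draw
  \<open>s + t\<close> vertices independently according to them. The probability that the outcome is an
  arc-preserving and arc-reflecting map from \<open>K\<close> to \<open>D\<close> is a polynomial in the weights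
  (\<open>hom_weight\<close>). At the uniform weights, \<open>n^(s + t)\<close> times it is at least \<open>s! t!\<close> times the number
  of induced copies, because each copy can be parametrised in at least \<open>s! t!\<close> ways
  (\<open>induced_copies_automorphisms_le\<close>, \<open>card_automorphisms_complete_bipartite\<close>).

  If \<open>u\<close> and \<open>v\<close> are nonadjacent in \<open>D\<close>, the polynomial does not decrease when all the weight of
  one of them, suitably chosen, moves to the other (\<open>hom_weight_symmetrize\<close>). The reason is that
  nonadjacent vertices of \<open>K\<close> are twins: a map that uses both \<open>u\<close> and \<open>v\<close> remains such a map if every
  \<open>v\<close> is replaced by \<open>u\<close>, or conversely. Repeating this, one may assume that the weights live on a
  tournament. There each part of \<open>K\<close> is mapped to a single vertex, and the polynomial becomes the
  sum of \<open>x_u^s x_v^t\<close> over the arcs \<open>(u, v)\<close>.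

  Finally, let \<open>p\<close> be the largest weight and \<open>q = 1 - p\<close>. The sum is at most \<open>p^t q^s\<close>: the arcs at
  the heaviest vertex contribute at most \<open>p^t\<close> times the sum of the \<open>s\<close>-th powers of the other
  weights, and for \<open>s \<ge> 2\<close> the mixed terms of the expansion of \<open>q^s\<close> pay for all other arcs
  (\<open>sum_arc_weight_le_power\<close>). By the inequality of arithmetic and geometric means,
  \<open>p^t q^s\<close> is at most \<open>s^s t^t / (s + t)^(s + t)\<close>, and multiplication by \<open>(s + t)! / (s! t!)\<close>
  gives the claimed constant.
\<close>

section \<open>Weighted tournaments\<close>

text \<open>
  Three terms of the binomial expansion. They are distinct only from exponent \<open>2\<close> on; this is where
  \<open>s \<ge> 2\<close> enters. For \<open>s = t = 1\<close> the extremal value is a different one: a tournament has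
  induced density \<open>1\<close> of single arcs.
\<close>

lemma power_add_ge:
  fixes a b :: real
  assumes "0 \<le> a" "0 \<le> b" "2 \<le> n"
  shows "a ^ n + b ^ n + a * b ^ (n - 1) \<le> (a + b) ^ n"
proof -
  have "a ^ Suc (Suc m) + b ^ Suc (Suc m) + a * b ^ Suc m \<le> (a + b) ^ Suc (Suc m)" for m
  proof (induction m)
    case 0
    show ?case using assms by (simp add: algebra_simps power2_eq_square)
  next
    case (Suc m)
    have "a ^ Suc (Suc (Suc m)) + b ^ Suc (Suc (Suc m)) + a * b ^ Suc (Suc m)
        \<le> (a + b) * (a ^ Suc (Suc m) + b ^ Suc (Suc m) + a * b ^ Suc m)"
      using assms by (simp add: algebra_simps)
    also have "\<dots> \<le> (a + b) * (a + b) ^ Suc (Suc m)"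
      using Suc assms by (intro mult_left_mono) auto
    finally show ?case by simp
  qed
  from this[of "n - 2"] show ?thesis using assms(3) by (simp add: numeral_2_eq_2 Suc_diff_Suc)
qed

text \<open>
  The weighted inequality of arithmetic and geometric means for two numbers of sum \<open>1\<close>. Rescale
  \<open>p\<close> and \<open>q\<close> by their optimal values \<open>t / (s + t)\<close> and \<open>s / (s + t)\<close> and apply
  \<open>x \<le> exp (x - 1)\<close> to both: the exponents add up to \<open>0\<close>.
\<close>

lemma power_mult_power_le:
  fixes p q :: real
  assumes "0 \<le> p" "0 \<le> q" "p + q = 1" "0 < s" "0 < t"
  shows "p ^ t * q ^ s \<le> real s ^ s * real t ^ t / real (s + t) ^ (s + t)"
proof -
  let ?x = "p * real (s + t) / real t" and ?y = "q * real (s + t) / real s"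
  have "?x ^ t * ?y ^ s \<le> exp (?x - 1) ^ t * exp (?y - 1) ^ s"
    using assms exp_ge_add_one_self[of "?x - 1"] exp_ge_add_one_self[of "?y - 1"]
    by (intro mult_mono power_mono) auto
  also have "\<dots> = exp (real t * (?x - 1) + real s * (?y - 1))"
    by (simp add: exp_add exp_of_nat_mult)
  also have "real t * (?x - 1) + real s * (?y - 1) = (p + q) * real (s + t) - real (s + t)"
  proof -
    have "real t * (?x - 1) = p * real (s + t) - real t" "real s * (?y - 1) = q * real (s + t) - real s"
      using assms by (simp_all add: right_diff_distrib)
    then show ?thesis by (simp only: distrib_right)
  qed
  also have "\<dots> = 0" using assms by simp
  finally have "p ^ t * q ^ s * real (s + t) ^ (s + t) / (real s ^ s * real t ^ t) \<le> 1"
    by (simp add: power_mult_distrib power_divide power_add mult_ac)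
  then show ?thesis using assms by (simp add: field_simps)
qed

definition arc_weight :: "('a \<times> 'a) set \<Rightarrow> nat \<Rightarrow> nat \<Rightarrow> ('a \<Rightarrow> real) \<Rightarrow> 'a \<Rightarrow> 'a \<Rightarrow> real" where
  "arc_weight E s t w u v = (if (u, v) \<in> E then w u ^ s * w v ^ t else 0)"

text \<open>
  At most one of the two arcs is present, and its weight is \<open>(w x * w y)^s\<close> times the
  \<open>(t - s)\<close>-th power of one of the two weights.
\<close>

lemma arc_weight_pair_le:
  assumes "(x, y) \<in> E \<Longrightarrow> (y, x) \<notin> E" "0 \<le> w x" "w x \<le> p" "0 \<le> w y" "w y \<le> p" "s \<le> t"
  shows "arc_weight E s t w x y + arc_weight E s t w y x \<le> p ^ (t - s) * (w x ^ s * w y ^ s)"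
proof -
  have t: "a ^ t = a ^ (t - s) * a ^ s" for a :: real
    using assms(6) by (simp flip: power_add)
  have "w x ^ s * w y ^ t \<le> p ^ (t - s) * (w x ^ s * w y ^ s)"
       "w y ^ s * w x ^ t \<le> p ^ (t - s) * (w x ^ s * w y ^ s)"
    using assms mult_right_mono[OF power_mono[of "w y" p "t - s"], of "w x ^ s * w y ^ s"]
      mult_right_mono[OF power_mono[of "w x" p "t - s"], of "w x ^ s * w y ^ s"]
    by (simp_all add: t mult_ac)
  moreover have "0 \<le> p ^ (t - s) * (w x ^ s * w y ^ s)"
    using assms by simp
  ultimately show ?thesis using assms(1) by (auto simp: arc_weight_def)
qed

lemma sum_arc_weight_insert:
  assumes "finite R" "x \<notin> R" "(x, x) \<notin> E"
  shows "(\<Sum>u\<in>insert x R. \<Sum>v\<in>insert x R. arc_weight E s t w u v)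
       = (\<Sum>y\<in>R. arc_weight E s t w x y + arc_weight E s t w y x)
         + (\<Sum>u\<in>R. \<Sum>v\<in>R. arc_weight E s t w u v)"
  using assms by (simp add: sum.distrib, simp add: arc_weight_def)

text \<open>
  By induction on \<open>R\<close>: when \<open>x\<close> is added to a set of total weight \<open>\<sigma>\<close>, the power
  \<open>(\<sigma> + w x)^s\<close> grows by at least \<open>(w x)^s + \<sigma> * (w x)^(s - 1)\<close>. The first summand accounts for
  the new power sum. The second one accounts for the new arcs, since the pair \<open>x, y\<close> carries at most
  \<open>p^(t - s) * (w x * w y)^s \<le> p^t * w y * (w x)^(s - 1)\<close>.
\<close>

lemma sum_arc_weight_le_power:
  assumes "finite R" "\<And>x. x \<in> R \<Longrightarrow> 0 \<le> w x \<and> w x \<le> p"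
    and asym: "\<And>x y. (x, y) \<in> E \<Longrightarrow> (y, x) \<notin> E" and st: "2 \<le> s" "s \<le> t" and p: "0 \<le> p"
  shows "p ^ t * (\<Sum>x\<in>R. w x ^ s) + (\<Sum>u\<in>R. \<Sum>v\<in>R. arc_weight E s t w u v) \<le> p ^ t * (\<Sum>x\<in>R. w x) ^ s"
  using assms(1,2)
proof (induction R)
  case empty
  then show ?case using st by (simp add: power_0_left)
next
  case (insert x R)
  let ?\<sigma> = "\<Sum>y\<in>R. w y"
  have x: "0 \<le> w x" "w x \<le> p" and R: "\<And>y. y \<in> R \<Longrightarrow> 0 \<le> w y \<and> w y \<le> p"
    using insert.prems by auto
  have \<sigma>: "0 \<le> ?\<sigma>" using R by (simp add: sum_nonneg)
  have pt: "p ^ (t - s) * (p ^ (s - 1) * p) = p ^ t"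
    using st by (metis Suc_diff_1 le_add_diff_inverse2 less_le_trans pos2 power_Suc2 power_add)
  have xs: "w x ^ s = w x * w x ^ (s - 1)"
    using st by (metis Suc_diff_1 less_le_trans pos2 power_Suc)
  have "arc_weight E s t w x y + arc_weight E s t w y x \<le> p ^ t * (w y * w x ^ (s - 1))"
    if y: "y \<in> R" for y
  proof -
    have "arc_weight E s t w x y + arc_weight E s t w y x \<le> p ^ (t - s) * (w x ^ s * w y ^ s)"
      using R[OF y] x asym[of x y] st by (intro arc_weight_pair_le) auto
    also have "w x ^ s * w y ^ s = (w y ^ (s - 1) * w x) * (w y * w x ^ (s - 1))"
      using st power_Suc[of "w y" "s - 1"] by (simp add: xs)
    also have "p ^ (t - s) * \<dots> \<le> p ^ (t - s) * ((p ^ (s - 1) * p) * (w y * w x ^ (s - 1)))"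
      using R[OF y] x p by (intro mult_left_mono mult_right_mono mult_mono power_mono) auto
    also have "\<dots> = p ^ t * (w y * w x ^ (s - 1))"
      unfolding pt[symmetric] by (simp only: mult_ac)
    finally show ?thesis .
  qed
  then have "(\<Sum>y\<in>R. arc_weight E s t w x y + arc_weight E s t w y x)
      \<le> p ^ t * (?\<sigma> * w x ^ (s - 1))"
    by (simp add: sum_distrib_left sum_distrib_right sum_mono)
  moreover have "p ^ t * (\<Sum>x\<in>R. w x ^ s) + (\<Sum>u\<in>R. \<Sum>v\<in>R. arc_weight E s t w u v) \<le> p ^ t * ?\<sigma> ^ s"
    by (rule insert.IH) (use R in auto)
  moreover have "p ^ t * (?\<sigma> ^ s + w x ^ s + ?\<sigma> * w x ^ (s - 1)) \<le> p ^ t * (?\<sigma> + w x) ^ s"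
    using power_add_ge[OF \<sigma> x(1) st(1)] p by (intro mult_left_mono) auto
  moreover have "(x, x) \<notin> E" using asym by blast
  ultimately show ?case
    by (subst sum_arc_weight_insert)
      (use insert.hyps in \<open>simp_all add: algebra_simps\<close>)
qed

text \<open>
  Split off a vertex \<open>m\<close> of largest weight \<open>p\<close>. Its arcs contribute at most \<open>p^t\<close> times the sum of the
  \<open>s\<close>-th powers of the other weights, whichever way they point, which is the extra term that
  \<open>sum_arc_weight_le_power\<close> makes room for.
\<close>

lemma sum_arc_weight_le:
  assumes fin: "finite X" and w: "\<And>x. x \<in> X \<Longrightarrow> 0 \<le> w x" "(\<Sum>x\<in>X. w x) = 1"
    and asym: "\<And>x y. (x, y) \<in> E \<Longrightarrow> (y, x) \<notin> E" and st: "2 \<le> s" "s \<le> t"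
  shows "(\<Sum>u\<in>X. \<Sum>v\<in>X. arc_weight E s t w u v) \<le> real s ^ s * real t ^ t / real (s + t) ^ (s + t)"
proof -
  have "X \<noteq> {}" using w(2) by auto
  then have "Max (w ` X) \<in> w ` X" using fin by simp
  then obtain m where m: "m \<in> X" "w m = Max (w ` X)" by auto
  have w_le: "w x \<le> w m" if "x \<in> X" for x
    using that fin m(2) by simp
  define R where "R = X - {m}"
  have X: "X = insert m R" "m \<notin> R" "finite R" using m(1) fin by (auto simp: R_def)
  have R: "0 \<le> w x \<and> w x \<le> w m" if "x \<in> R" for x using that w(1) w_le by (auto simp: R_def)
  have pt: "w m ^ (t - s) * (w m ^ s * b) = w m ^ t * b" for b :: real
    using st by (metis le_add_diff_inverse2 mult.assoc power_add)
  have "(\<Sum>y\<in>R. arc_weight E s t w m y + arc_weight E s t w y m) \<le> (\<Sum>y\<in>R. w m ^ t * w y ^ s)"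
  proof (rule sum_mono)
    fix y assume "y \<in> R"
    then show "arc_weight E s t w m y + arc_weight E s t w y m \<le> w m ^ t * w y ^ s"
      using arc_weight_pair_le[of m y E w "w m" s t] asym R w(1)[OF m(1)] st(2) by (simp add: pt)
  qed
  also have "\<dots> = w m ^ t * (\<Sum>y\<in>R. w y ^ s)"
    by (simp add: sum_distrib_left)
  also have "\<dots> + (\<Sum>u\<in>R. \<Sum>v\<in>R. arc_weight E s t w u v) \<le> w m ^ t * (\<Sum>x\<in>R. w x) ^ s"
    by (rule sum_arc_weight_le_power) (use R asym st w(1)[OF m(1)] X(3) in auto)
  finally have "(\<Sum>y\<in>R. arc_weight E s t w m y + arc_weight E s t w y m)
      + (\<Sum>u\<in>R. \<Sum>v\<in>R. arc_weight E s t w u v) \<le> w m ^ t * (\<Sum>x\<in>R. w x) ^ s"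
    by simp
  moreover have "(m, m) \<notin> E" using asym by blast
  ultimately have "(\<Sum>u\<in>X. \<Sum>v\<in>X. arc_weight E s t w u v) \<le> w m ^ t * (\<Sum>x\<in>R. w x) ^ s"
    unfolding X(1) by (subst sum_arc_weight_insert) (use X in auto)
  also have "\<dots> \<le> real s ^ s * real t ^ t / real (s + t) ^ (s + t)"
    using w X R m(1) st by (intro power_mult_power_le) (auto simp: sum_nonneg)
  finally show ?thesis .
qed

section \<open>Symmetrization of weighted homomorphism counts\<close>

text \<open>
  Maps that both preserve and reflect arcs. They need not be injective: a vertex of the target
  may be used several times by pairwise nonadjacent vertices of \<open>K\<close>, as if it were blown up to an
  independent set.
\<close>

definition strong_homs :: "'a pair_pre_digraph \<Rightarrow> ('b \<times> 'b) set \<Rightarrow> 'b set \<Rightarrow> ('a \<Rightarrow> 'b) set" where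
  "strong_homs K E X = {\<sigma> \<in> pverts K \<rightarrow>\<^sub>E X.
     \<forall>i\<in>pverts K. \<forall>j\<in>pverts K. (\<sigma> i, \<sigma> j) \<in> E \<longleftrightarrow> (i, j) \<in> parcs K}"

definition hom_weight :: "'a pair_pre_digraph \<Rightarrow> ('b \<times> 'b) set \<Rightarrow> ('b \<Rightarrow> real) \<Rightarrow> 'b set \<Rightarrow> real" where
  "hom_weight K E w X = (\<Sum>\<sigma>\<in>strong_homs K E X. \<Prod>i\<in>pverts K. w (\<sigma> i))"

text \<open>
  The property of complete multipartite digraphs on which symmetrization rests: nonadjacent
  vertices have the same in-neighbours and the same out-neighbours.
\<close>

definition twin_closed :: "'a pair_pre_digraph \<Rightarrow> bool" where
  "twin_closed K \<longleftrightarrow> (\<forall>i\<in>pverts K. \<forall>j\<in>pverts K. \<forall>k\<in>pverts K.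
     (i, j) \<notin> parcs K \<longrightarrow> (j, i) \<notin> parcs K \<longrightarrow>
     ((i, k) \<in> parcs K \<longleftrightarrow> (j, k) \<in> parcs K) \<and> ((k, i) \<in> parcs K \<longleftrightarrow> (k, j) \<in> parcs K))"

definition merge_into :: "'a set \<Rightarrow> 'b \<Rightarrow> 'b \<Rightarrow> ('a \<Rightarrow> 'b) \<Rightarrow> 'a \<Rightarrow> 'b" where
  "merge_into I u v \<sigma> = (\<lambda>i\<in>I. if \<sigma> i = v then u else \<sigma> i)"

lemma strong_homs_in_PiE: "\<sigma> \<in> strong_homs K E X \<Longrightarrow> \<sigma> \<in> pverts K \<rightarrow>\<^sub>E X"
  by (simp add: strong_homs_def)

lemma finite_strong_homs:
  assumes "finite (pverts K)" "finite X" shows "finite (strong_homs K E X)"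
  by (rule finite_subset[OF _ finite_PiE[OF assms]]) (auto simp: strong_homs_def)

text \<open>
  As \<open>u\<close> and \<open>v\<close> are nonadjacent, every vertex sent to \<open>v\<close> is nonadjacent in \<open>K\<close> to \<open>i0\<close>, which is
  sent to \<open>u\<close>. Hence it is a twin of \<open>i0\<close> and may be sent to \<open>u\<close> as well.
\<close>

lemma strong_homs_merge_into:
  assumes K: "twin_closed K" and nonadj: "(u, v) \<notin> E" "(v, u) \<notin> E"
    and \<sigma>: "\<sigma> \<in> strong_homs K E X" and i0: "i0 \<in> pverts K" "\<sigma> i0 = u"
    and "u \<noteq> v"
  shows "merge_into (pverts K) u v \<sigma> \<in> strong_homs K E (X - {v})"
proof -
  have \<sigma>E: "(\<sigma> i, \<sigma> j) \<in> E \<longleftrightarrow> (i, j) \<in> parcs K" if "i \<in> pverts K" "j \<in> pverts K" for i j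
    using \<sigma> that by (auto simp: strong_homs_def)
  have \<sigma>X: "\<sigma> i \<in> X" if "i \<in> pverts K" for i
    using \<sigma> that by (auto simp: strong_homs_def)
  \<comment> \<open>Merging on the target side is the same as redirecting those vertices to \<open>i0\<close> on the source side.\<close>
  define r where "r i = (if \<sigma> i = v then i0 else i)" for i
  have r: "r i \<in> pverts K" if "i \<in> pverts K" for i
    using that i0 by (simp add: r_def)
  have merge: "merge_into (pverts K) u v \<sigma> i = \<sigma> (r i)" if "i \<in> pverts K" for i
    using that i0 by (simp add: r_def merge_into_def)
  have twin: "((r i, k) \<in> parcs K \<longleftrightarrow> (i, k) \<in> parcs K) \<and> ((k, r i) \<in> parcs K \<longleftrightarrow> (k, i) \<in> parcs K)"
    if "i \<in> pverts K" "k \<in> pverts K" for i k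
  proof (cases "\<sigma> i = v")
    case True
    then have "(i0, i) \<notin> parcs K" "(i, i0) \<notin> parcs K"
      using \<sigma>E[of i0 i] \<sigma>E[of i i0] i0 nonadj that by auto
    then have "((i0, k) \<in> parcs K \<longleftrightarrow> (i, k) \<in> parcs K) \<and> ((k, i0) \<in> parcs K \<longleftrightarrow> (k, i) \<in> parcs K)"
      using K that i0(1) unfolding twin_closed_def by blast
    then show ?thesis using True by (simp add: r_def)
  qed (simp add: r_def)
  show ?thesis
    unfolding strong_homs_def
  proof (intro CollectI conjI ballI)
    show "merge_into (pverts K) u v \<sigma> \<in> pverts K \<rightarrow>\<^sub>E X - {v}"
      using \<sigma>X i0 \<open>u \<noteq> v\<close> by (auto simp: merge_into_def split: if_splits)
    fix i j assume "i \<in> pverts K" "j \<in> pverts K"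
    then show "(merge_into (pverts K) u v \<sigma> i, merge_into (pverts K) u v \<sigma> j) \<in> E \<longleftrightarrow> (i, j) \<in> parcs K"
      using twin[of i "r j"] twin[of j i] by (simp add: merge \<sigma>E r)
  qed
qed

lemma merge_into_inverse:
  assumes "\<rho> \<in> I \<rightarrow>\<^sub>E X - {v}"
  shows "merge_into I u v (merge_into I v u \<rho>) = \<rho>"
  using assms by (auto simp: merge_into_def PiE_iff fun_eq_iff extensional_def)

lemma merge_into_merge_into:
  "u \<noteq> v \<Longrightarrow> merge_into I v u (merge_into I u v \<sigma>) = merge_into I v u \<sigma>"
  by (auto simp: merge_into_def fun_eq_iff)

lemma merge_into_in_PiE:
  assumes "\<sigma> \<in> I \<rightarrow>\<^sub>E X" "u \<in> X" "u \<noteq> v"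
  shows "merge_into I u v \<sigma> \<in> I \<rightarrow>\<^sub>E X - {v}"
  using assms by (auto simp: merge_into_def PiE_iff)

lemma merge_into_id:
  assumes "\<sigma> \<in> I \<rightarrow>\<^sub>E X" "\<And>i. i \<in> I \<Longrightarrow> \<sigma> i \<noteq> v"
  shows "merge_into I u v \<sigma> = \<sigma>"
  using assms by (auto simp: merge_into_def PiE_iff fun_eq_iff extensional_def)

text \<open>
  Replacing all factors by larger ones gains at least the quotient \<open>w' y / w x\<close> of the factors at one
  place \<open>i0\<close>. In the application \<open>x\<close> is one of two merged vertices, used at least once, and \<open>w' y\<close> is
  their joint weight. The form without division also covers weight \<open>0\<close>.
\<close>

lemma prod_weight_le_merged:
  fixes w :: "'b \<Rightarrow> real"
  assumes I: "finite I" "i0 \<in> I" "\<sigma> i0 = x" "\<tau> i0 = y" and "0 \<le> w x"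
    and le: "\<And>i. i \<in> I \<Longrightarrow> 0 \<le> w (\<sigma> i) \<and> w (\<sigma> i) \<le> w' (\<tau> i)"
  shows "w' y * (\<Prod>i\<in>I. w (\<sigma> i)) \<le> w x * (\<Prod>i\<in>I. w' (\<tau> i))"
proof -
  have "(\<Prod>i\<in>I - {i0}. w (\<sigma> i)) \<le> (\<Prod>i\<in>I - {i0}. w' (\<tau> i))"
    using le by (intro prod_mono) auto
  moreover have "0 \<le> w' y"
    using le[OF I(2)] I by auto
  ultimately have "w' y * w x * (\<Prod>i\<in>I - {i0}. w (\<sigma> i)) \<le> w' y * w x * (\<Prod>i\<in>I - {i0}. w' (\<tau> i))"
    using \<open>0 \<le> w x\<close> by (intro mult_left_mono) auto
  then show ?thesis
    using I(3,4) by (simp add: prod.remove[OF I(1,2)] mult_ac)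
qed

text \<open>
  Merging \<open>v\<close> into \<open>u\<close> pushes the product weight forward to the product weight in which \<open>u\<close>
  carries the sum of both weights.
\<close>

lemma sum_fiber_merge_into:
  fixes w :: "'b \<Rightarrow> real"
  assumes I: "finite I" and X: "finite X" "u \<in> X" "v \<in> X" "u \<noteq> v" and \<rho>: "\<rho> \<in> I \<rightarrow>\<^sub>E X - {v}"
  shows "(\<Sum>\<sigma> | \<sigma> \<in> I \<rightarrow>\<^sub>E X \<and> merge_into I u v \<sigma> = \<rho>. \<Prod>i\<in>I. w (\<sigma> i))
       = (\<Prod>i\<in>I. (w(u := w u + w v)) (\<rho> i))"
proof -
  let ?B = "\<lambda>i. {x \<in> X. (if x = v then u else x) = \<rho> i}"
  have "{\<sigma>. \<sigma> \<in> I \<rightarrow>\<^sub>E X \<and> merge_into I u v \<sigma> = \<rho>} = PiE I ?B"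
    using \<rho> by (auto simp: merge_into_def PiE_iff fun_eq_iff extensional_def)
  then have "(\<Sum>\<sigma> | \<sigma> \<in> I \<rightarrow>\<^sub>E X \<and> merge_into I u v \<sigma> = \<rho>. \<Prod>i\<in>I. w (\<sigma> i))
       = (\<Prod>i\<in>I. \<Sum>x\<in>?B i. w x)"
    using I X by (simp add: prod_sum_PiE)
  also have "\<dots> = (\<Prod>i\<in>I. (w(u := w u + w v)) (\<rho> i))"
  proof (rule prod.cong)
    fix i assume "i \<in> I"
    then have i: "\<rho> i \<in> X" "\<rho> i \<noteq> v" using \<rho> by auto
    have "?B i = (if \<rho> i = u then {u, v} else {\<rho> i})"
      using i X by auto
    then show "(\<Sum>x\<in>?B i. w x) = (w(u := w u + w v)) (\<rho> i)"
      using X(4) by simp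
  qed simp
  finally show ?thesis .
qed

text \<open>
  The symmetrization inequality for the maps that become \<open>\<rho>\<close> when \<open>v\<close> is merged into \<open>u\<close>. Let \<open>c\<close>
  be the joint weight of \<open>u\<close> and \<open>v\<close>. If both \<open>\<rho>\<close> and its mirror image, in which \<open>v\<close> takes the place
  of \<open>u\<close>, are strong homomorphisms, the fiber has weight at most \<open>P\<close>, and \<open>c = w u + w v\<close>. If only
  \<open>\<rho>\<close> is one, then no strong homomorphism in the fiber uses \<open>v\<close>, so only \<open>\<rho>\<close> itself remains;
  its weight is at most \<open>w u / c\<close> times \<open>P\<close>. The mirrored case is the same with \<open>w v\<close>. If neither is
  one, the fiber contains no strong homomorphism.
\<close>

lemma fiber_weight_le:
  fixes w :: "'b \<Rightarrow> real"
  assumes K: "twin_closed K" "finite (pverts K)"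
    and X: "finite X" "u \<in> X" "v \<in> X" "u \<noteq> v" and nonadj: "(u, v) \<notin> E" "(v, u) \<notin> E"
    and w: "\<And>x. x \<in> X \<Longrightarrow> 0 \<le> w x"
    and \<rho>: "\<rho> \<in> pverts K \<rightarrow>\<^sub>E X - {v}"
  defines "c \<equiv> w u + w v"
  defines "F \<equiv> {\<sigma> \<in> strong_homs K E X. merge_into (pverts K) u v \<sigma> = \<rho>}"
  defines "P \<equiv> (\<Prod>i\<in>pverts K. (w(u := c)) (\<rho> i))"
  shows "c * (\<Sum>\<sigma>\<in>F. \<Prod>i\<in>pverts K. w (\<sigma> i))
    \<le> w u * (if \<rho> \<in> strong_homs K E (X - {v}) then P else 0)
      + w v * (if merge_into (pverts K) v u \<rho> \<in> strong_homs K E (X - {u}) then P else 0)"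
proof -
  let ?I = "pverts K"
  let ?\<rho>' = "merge_into ?I v u \<rho>"
  let ?A = "\<rho> \<in> strong_homs K E (X - {v})" and ?B = "?\<rho>' \<in> strong_homs K E (X - {u})"
  let ?W = "\<lambda>\<sigma>. \<Prod>i\<in>?I. w (\<sigma> i)"
  have pos: "0 \<le> w u" "0 \<le> w v" "0 \<le> c" using w X by (auto simp: c_def)
  have FX: "\<sigma> \<in> ?I \<rightarrow>\<^sub>E X" if "\<sigma> \<in> F" for \<sigma>
    using that by (auto simp: F_def strong_homs_def)
  have finF: "finite F" using K X by (simp add: F_def finite_strong_homs)
  have F_merge: "merge_into ?I v u \<sigma> = ?\<rho>'" if "\<sigma> \<in> F" for \<sigma>
    using that merge_into_merge_into[OF X(4), of ?I \<sigma>] by (simp add: F_def)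
  have B: ?B if "\<sigma> \<in> F" "i \<in> ?I" "\<sigma> i = v" for \<sigma> i
    using strong_homs_merge_into[OF K(1) nonadj(2,1), of \<sigma> X i] F_merge[OF that(1)] that X(4) by (simp add: F_def)
  have A: ?A if "\<sigma> \<in> F" "i \<in> ?I" "\<sigma> i = u" for \<sigma> i
    using strong_homs_merge_into[OF K(1) nonadj, of \<sigma> X i] that X(4) by (simp add: F_def)
  have only_\<rho>: "\<sigma> = \<rho>" if "\<sigma> \<in> F" "\<not> ?B" for \<sigma>
  proof -
    have "\<sigma> i \<noteq> v" if "i \<in> ?I" for i using B[OF \<open>\<sigma> \<in> F\<close> that] \<open>\<not> ?B\<close> by blast
    then have "merge_into ?I u v \<sigma> = \<sigma>" by (rule merge_into_id[OF FX[OF \<open>\<sigma> \<in> F\<close>]])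
    then show ?thesis using \<open>\<sigma> \<in> F\<close> by (simp add: F_def)
  qed
  have only_\<rho>': "\<sigma> = ?\<rho>'" if "\<sigma> \<in> F" "\<not> ?A" for \<sigma>
  proof -
    have "\<sigma> i \<noteq> u" if "i \<in> ?I" for i using A[OF \<open>\<sigma> \<in> F\<close> that] \<open>\<not> ?A\<close> by blast
    then have "merge_into ?I v u \<sigma> = \<sigma>" by (rule merge_into_id[OF FX[OF \<open>\<sigma> \<in> F\<close>]])
    then show ?thesis using F_merge[OF \<open>\<sigma> \<in> F\<close>] by simp
  qed
  have W0: "0 \<le> ?W \<sigma>" if "\<sigma> \<in> ?I \<rightarrow>\<^sub>E X" for \<sigma>
    using that w by (intro prod_nonneg) auto
  have \<rho>X: "\<rho> \<in> ?I \<rightarrow>\<^sub>E X" using \<rho> by auto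
  have P0: "0 \<le> P" unfolding P_def using \<rho> w pos by (intro prod_nonneg) (auto simp: PiE_iff)
  show ?thesis
  proof (cases ?A)
    case True
    show ?thesis
    proof (cases ?B)
      case B: True
      have "(\<Sum>\<sigma>\<in>F. ?W \<sigma>) \<le> (\<Sum>\<sigma> | \<sigma> \<in> ?I \<rightarrow>\<^sub>E X \<and> merge_into ?I u v \<sigma> = \<rho>. ?W \<sigma>)"
        using K X W0 FX finite_PiE[of ?I "\<lambda>_. X"] by (intro sum_mono2) (auto simp: F_def)
      also have "\<dots> = P"
        using sum_fiber_merge_into[OF K(2) X \<rho>, of w] by (simp add: P_def c_def)
      finally have "c * (\<Sum>\<sigma>\<in>F. ?W \<sigma>) \<le> c * P"
        using pos by (intro mult_left_mono)
      then show ?thesis using True B by (simp add: c_def algebra_simps)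
    next
      case notB: False
      \<comment> \<open>If \<open>\<rho>\<close> avoided \<open>u\<close>, it would be its own mirror image.\<close>
      obtain i0 where i0: "i0 \<in> ?I" "\<rho> i0 = u"
      proof (rule ccontr)
        assume "\<not> thesis"
        then have avoid: "\<And>i. i \<in> ?I \<Longrightarrow> \<rho> i \<noteq> u" using that by blast
        then have "?\<rho>' = \<rho>" using merge_into_id[OF \<rho>X, of u v] by auto
        moreover have "\<rho> \<in> strong_homs K E (X - {u})"
          using avoid True by (auto simp: strong_homs_def PiE_iff)
        ultimately show False using notB by simp
      qed
      have "(\<Sum>\<sigma>\<in>F. ?W \<sigma>) \<le> (\<Sum>\<sigma>\<in>{\<rho>}. ?W \<sigma>)"
        using only_\<rho> notB W0[OF \<rho>X] by (intro sum_mono2) auto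
      then have "c * (\<Sum>\<sigma>\<in>F. ?W \<sigma>) \<le> c * ?W \<rho>"
        using pos by (intro mult_left_mono) auto
      also have "\<dots> \<le> w u * P"
        unfolding P_def
        using prod_weight_le_merged[of ?I i0 \<rho> u \<rho> u w "w(u := c)"] i0 K(2) pos \<rho> w
        by (auto simp: c_def PiE_iff)
      finally show ?thesis using True notB by simp
    qed
  next
    case notA: False
    show ?thesis
    proof (cases "F = {}")
      case True
      then show ?thesis using pos P0 by simp
    next
      case False
      then have F: "F = {?\<rho>'}" using only_\<rho>' notA by auto
      have \<rho>': "?\<rho>' \<in> ?I \<rightarrow>\<^sub>E X - {u}"
        using merge_into_in_PiE[OF \<rho>X X(3)] X(4) by auto
      have "?\<rho>' \<in> F" using F by auto
      obtain i0 where i0: "i0 \<in> ?I" "?\<rho>' i0 = v"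
      proof (rule ccontr)
        assume "\<not> thesis"
        then have "\<And>i. i \<in> ?I \<Longrightarrow> ?\<rho>' i \<noteq> v" using that by blast
        then have "merge_into ?I u v ?\<rho>' = ?\<rho>'"
          using merge_into_id[OF \<rho>', of v u] by auto
        then have "?\<rho>' = \<rho>" using merge_into_inverse[OF \<rho>, of u] by simp
        then have "?A" using \<open>?\<rho>' \<in> F\<close> \<rho> by (auto simp: F_def strong_homs_def)
        then show False using notA by simp
      qed
      have \<rho>i0: "\<rho> i0 = u"
        using i0 \<rho> by (auto simp: merge_into_def split: if_splits)
      have ?B using B[OF \<open>?\<rho>' \<in> F\<close> i0] .
      have "c * (\<Sum>\<sigma>\<in>F. ?W \<sigma>) = c * ?W ?\<rho>'" by (simp add: F)
      also have "\<dots> \<le> w v * P"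
        unfolding P_def
        using prod_weight_le_merged[of ?I i0 ?\<rho>' v \<rho> u w "w(u := c)"] i0 \<rho>i0 K(2) pos \<rho> w
        by (auto simp: c_def PiE_iff merge_into_def)
      finally show ?thesis using notA \<open>?B\<close> by simp
    qed
  qed
qed

text \<open>
  With \<open>c > 0\<close> the value at \<open>w\<close> is at most a convex combination, with coefficients \<open>w u / c\<close> and
  \<open>w v / c\<close>, of the values after moving all weight to \<open>u\<close> and to \<open>v\<close>. Both merged values are
  written as sums over the same index set, the maps avoiding \<open>v\<close>; for the second this exchanges the
  roles of \<open>u\<close> and \<open>v\<close>.
\<close>

lemma hom_weight_symmetrize:
  fixes w :: "'b \<Rightarrow> real"
  assumes K: "twin_closed K" "finite (pverts K)"
    and X: "finite X" "u \<in> X" "v \<in> X" "u \<noteq> v" and nonadj: "(u, v) \<notin> E" "(v, u) \<notin> E"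
    and w: "\<And>x. x \<in> X \<Longrightarrow> 0 \<le> w x"
  defines "c \<equiv> w u + w v"
  shows "c * hom_weight K E w X
    \<le> w u * hom_weight K E (w(u := c)) (X - {v}) + w v * hom_weight K E (w(v := c)) (X - {u})"
proof -
  let ?I = "pverts K"
  let ?R = "?I \<rightarrow>\<^sub>E X - {v}" and ?m = "merge_into ?I v u"
  let ?P = "\<lambda>\<rho>. \<Prod>i\<in>?I. (w(u := c)) (\<rho> i)"
  have finR: "finite ?R" using K X by (simp add: finite_PiE)
  have sub: "strong_homs K E (X - {v}) \<subseteq> ?R" by (auto simp: strong_homs_def)
  have "c * hom_weight K E w X
      = c * (\<Sum>\<rho>\<in>?R. \<Sum>\<sigma> | \<sigma> \<in> strong_homs K E X \<and> merge_into ?I u v \<sigma> = \<rho>. \<Prod>i\<in>?I. w (\<sigma> i))"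
    unfolding hom_weight_def using K X finR
    by (subst sum.group)
      (use X strong_homs_in_PiE[of _ K E X] in
        \<open>simp_all add: finite_strong_homs image_subset_iff merge_into_in_PiE\<close>)
  also have "\<dots> \<le> (\<Sum>\<rho>\<in>?R. w u * (if \<rho> \<in> strong_homs K E (X - {v}) then ?P \<rho> else 0)
      + w v * (if ?m \<rho> \<in> strong_homs K E (X - {u}) then ?P \<rho> else 0))"
    unfolding sum_distrib_left[of c _ ?R]
    by (intro sum_mono) (rule fiber_weight_le[where w = w, OF K X nonadj w, folded c_def])
  also have "\<dots> = w u * (\<Sum>\<rho>\<in>?R. if \<rho> \<in> strong_homs K E (X - {v}) then ?P \<rho> else 0)
      + w v * (\<Sum>\<rho>\<in>?R. if ?m \<rho> \<in> strong_homs K E (X - {u}) then ?P \<rho> else 0)"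
    by (simp add: sum.distrib sum_distrib_left)
  also have "(\<Sum>\<rho>\<in>?R. if \<rho> \<in> strong_homs K E (X - {v}) then ?P \<rho> else 0)
      = hom_weight K E (w(u := c)) (X - {v})"
  proof -
    have "{\<rho> \<in> ?R. \<rho> \<in> strong_homs K E (X - {v})} = strong_homs K E (X - {v})"
      using sub by blast
    then show ?thesis
      by (simp only: hom_weight_def sum.inter_filter[OF finR, symmetric])
  qed
  also have "(\<Sum>\<rho>\<in>?R. if ?m \<rho> \<in> strong_homs K E (X - {u}) then ?P \<rho> else 0)
      = hom_weight K E (w(v := c)) (X - {u})"
  proof -
    have "(\<Sum>\<rho>\<in>?R. if ?m \<rho> \<in> strong_homs K E (X - {u}) then ?P \<rho> else 0)
        = (\<Sum>\<rho> | \<rho> \<in> ?R \<and> ?m \<rho> \<in> strong_homs K E (X - {u}). ?P \<rho>)"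
      by (simp only: sum.inter_filter[OF finR])
    also have "\<dots> = hom_weight K E (w(v := c)) (X - {u})"
      unfolding hom_weight_def
    proof (rule sum.reindex_bij_witness[where i = "merge_into ?I u v" and j = ?m])
      fix \<rho> assume "\<rho> \<in> {\<rho>. \<rho> \<in> ?R \<and> ?m \<rho> \<in> strong_homs K E (X - {u})}"
      then have \<rho>: "\<rho> \<in> ?R" "?m \<rho> \<in> strong_homs K E (X - {u})" by auto
      show "merge_into ?I u v (?m \<rho>) = \<rho>" by (rule merge_into_inverse[OF \<rho>(1)])
      show "?m \<rho> \<in> strong_homs K E (X - {u})" by (rule \<rho>(2))
      show "(\<Prod>i\<in>?I. (w(v := c)) (?m \<rho> i)) = ?P \<rho>"
        using \<rho>(1) by (intro prod.cong) (auto simp: merge_into_def)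
    next
      fix \<tau> assume \<tau>: "\<tau> \<in> strong_homs K E (X - {u})"
      then have \<tau>X: "\<tau> \<in> ?I \<rightarrow>\<^sub>E X - {u}" by (simp add: strong_homs_def)
      show "?m (merge_into ?I u v \<tau>) = \<tau>" by (rule merge_into_inverse[OF \<tau>X])
      moreover have "merge_into ?I u v \<tau> \<in> ?R"
        using \<tau>X X by (intro merge_into_in_PiE) auto
      ultimately show "merge_into ?I u v \<tau> \<in> {\<rho>. \<rho> \<in> ?R \<and> ?m \<rho> \<in> strong_homs K E (X - {u})}"
        using \<tau> by simp
    qed
    finally show ?thesis .
  qed
  finally show ?thesis .
qed

text \<open>
  A weighting of maximal value can be taken with pairwise adjacent support: each symmetrization
  step preserves the total weight, removes a vertex, and one of its two outcomes is at least as
  good as the original weighting.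
\<close>

lemma hom_weight_le_if_le_on_tournaments:
  fixes w :: "'b \<Rightarrow> real"
  assumes K: "twin_closed K" "finite (pverts K)"
    and tournament: "\<And>X w. finite X \<Longrightarrow> (\<And>x. x \<in> X \<Longrightarrow> 0 \<le> w x) \<Longrightarrow> (\<Sum>x\<in>X. w x) = 1 \<Longrightarrow>
      (\<And>u v. u \<in> X \<Longrightarrow> v \<in> X \<Longrightarrow> u \<noteq> v \<Longrightarrow> (u, v) \<in> E \<or> (v, u) \<in> E) \<Longrightarrow> hom_weight K E w X \<le> M"
  shows "finite X \<Longrightarrow> (\<And>x. x \<in> X \<Longrightarrow> 0 \<le> w x) \<Longrightarrow> (\<Sum>x\<in>X. w x) = 1 \<Longrightarrow> hom_weight K E w X \<le> M"
proof (induction "card X" arbitrary: X w rule: less_induct)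
  case less
  note X = less.prems(1) and w = less.prems(2) and w1 = less.prems(3)
  show ?case
  proof (cases "\<forall>u\<in>X. \<forall>v\<in>X. u \<noteq> v \<longrightarrow> (u, v) \<in> E \<or> (v, u) \<in> E")
    case True
    then show ?thesis using tournament[OF X w w1] by blast
  next
    case False
    then obtain u v where uv: "u \<in> X" "v \<in> X" "u \<noteq> v" and nonadj: "(u, v) \<notin> E" "(v, u) \<notin> E"
      by blast
    define c where "c = w u + w v"
    have merged: "hom_weight K E (w(a := c)) (X - {b}) \<le> M"
      if ab: "a \<in> X" "b \<in> X" "a \<noteq> b" "c = w a + w b" for a b
    proof (rule less.hyps)
      show "card (X - {b}) < card X" using ab X by (intro psubset_card_mono) auto
      show "0 \<le> (w(a := c)) x" if "x \<in> X - {b}" for x using that w ab by auto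
      have "(\<Sum>x\<in>X - {b}. (w(a := c)) x) = c + (\<Sum>x\<in>X - {b} - {a}. (w(a := c)) x)"
        using ab X by (subst sum.remove[where x = a]) auto
      also have "(\<Sum>x\<in>X - {b} - {a}. (w(a := c)) x) = (\<Sum>x\<in>X - {b} - {a}. w x)"
        by (intro sum.cong) auto
      also have "c + \<dots> = (\<Sum>x\<in>X. w x)"
        using ab X by (subst sum.remove[of X b], simp, simp, subst sum.remove[of "X - {b}" a]) auto
      finally show "(\<Sum>x\<in>X - {b}. (w(a := c)) x) = 1" using w1 by simp
    qed (use X in auto)
    have u: "hom_weight K E (w(u := c)) (X - {v}) \<le> M" and v: "hom_weight K E (w(v := c)) (X - {u}) \<le> M"
      using merged[of u v] merged[of v u] uv by (auto simp: c_def)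
    have pos: "0 \<le> w u" "0 \<le> w v" using w uv by auto
    show ?thesis
    proof (cases "c = 0")
      case False
      have "c * hom_weight K E w X \<le> w u * M + w v * M"
        using hom_weight_symmetrize[where w = w, OF K X uv nonadj w] mult_left_mono[OF u pos(1)] mult_left_mono[OF v pos(2)]
        by (simp add: c_def)
      also have "\<dots> = c * M" by (simp add: c_def algebra_simps)
      finally show ?thesis
        using False pos by (subst (asm) mult_le_cancel_left_pos) (auto simp: c_def)
    next
      case True
      \<comment> \<open>The symmetrization inequality is void here, but a vertex of weight \<open>0\<close> can simply be dropped.\<close>
      then have "w v = 0" "w u = 0" using pos by (auto simp: c_def)
      have "hom_weight K E w X = hom_weight K E w (X - {v})"
        unfolding hom_weight_def
      proof (rule sum.mono_neutral_right)
        show "\<forall>\<sigma>\<in>strong_homs K E X - strong_homs K E (X - {v}). (\<Prod>i\<in>pverts K. w (\<sigma> i)) = 0"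
        proof
          fix \<sigma> assume "\<sigma> \<in> strong_homs K E X - strong_homs K E (X - {v})"
          then obtain i where "i \<in> pverts K" "\<sigma> i = v" by (auto simp: strong_homs_def PiE_iff)
          then show "(\<Prod>i\<in>pverts K. w (\<sigma> i)) = 0" using \<open>w v = 0\<close> K(2) by auto
        qed
      next
        show "finite (strong_homs K E X)" by (rule finite_strong_homs[OF K(2) X])
      qed (auto simp: strong_homs_def PiE_iff)
      moreover have "w(u := c) = w" using \<open>w u = 0\<close> True by auto
      ultimately show ?thesis using u by simp
    qed
  qed
qed

section \<open>The polynomial of the complete bipartite digraph\<close>

lemma pverts_complete_bipartite [simp]: "pverts (complete_bipartite_digraph a b) = {1..a + b}"
  by (simp add: complete_bipartite_digraph_def)

lemma parcs_complete_bipartite [simp]: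
  "(i, j) \<in> parcs (complete_bipartite_digraph a b) \<longleftrightarrow> i \<in> {1..a} \<and> j \<in> {a + 1..a + b}"
proof
  assume "i \<in> {1..a} \<and> j \<in> {a + 1..a + b}"
  then have "j = a + (j - a)" "j - a \<in> {1..b}" "i \<in> {1..a}" by auto
  then show "(i, j) \<in> parcs (complete_bipartite_digraph a b)"
    unfolding complete_bipartite_digraph_def by auto
qed (auto simp: complete_bipartite_digraph_def)

lemma twin_closed_complete_bipartite: "twin_closed (complete_bipartite_digraph s t)"
  by (auto simp: twin_closed_def)

text \<open>
  In a tournament two distinct vertices are adjacent, so a strong homomorphism is constant on each
  of the two independent parts and is determined by the images of \<open>1\<close> and \<open>s + t\<close>.
\<close>

lemma hom_weight_complete_bipartite_tournament:
  fixes w :: "'a \<Rightarrow> real"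
  assumes X: "finite X" "\<And>x. x \<in> X \<Longrightarrow> 0 \<le> w x"
    and tournament: "\<And>u v. u \<in> X \<Longrightarrow> v \<in> X \<Longrightarrow> u \<noteq> v \<Longrightarrow> (u, v) \<in> E \<or> (v, u) \<in> E"
    and st: "0 < s" "0 < t"
  shows "hom_weight (complete_bipartite_digraph s t) E w X \<le> (\<Sum>u\<in>X. \<Sum>v\<in>X. arc_weight E s t w u v)"
proof -
  let ?K = "complete_bipartite_digraph s t" and ?I = "{1..s + t}"
  let ?f = "\<lambda>(u, v). \<lambda>i\<in>?I. if i \<le> s then u else v"
  have I: "?I = {1..s} \<union> {s + 1..s + t}" by auto
  have sub: "strong_homs ?K E X \<subseteq> ?f ` (E \<inter> X \<times> X)"
  proof
    fix \<sigma> assume "\<sigma> \<in> strong_homs ?K E X"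
    then have \<sigma>X: "\<sigma> \<in> ?I \<rightarrow>\<^sub>E X"
      and \<sigma>: "\<And>i j. i \<in> ?I \<Longrightarrow> j \<in> ?I \<Longrightarrow> (\<sigma> i, \<sigma> j) \<in> E \<longleftrightarrow> i \<in> {1..s} \<and> j \<in> {s + 1..s + t}"
      by (auto simp: strong_homs_def)
    have same: "\<sigma> i = \<sigma> j" if "i \<in> ?I" "j \<in> ?I" "i \<le> s \<longleftrightarrow> j \<le> s" for i j
      using tournament[of "\<sigma> i" "\<sigma> j", OF PiE_mem[OF \<sigma>X that(1)] PiE_mem[OF \<sigma>X that(2)]]
        \<sigma>[of i j] \<sigma>[of j i] that by auto
    have "\<sigma> = ?f (\<sigma> 1, \<sigma> (s + t))"
    proof
      fix i
      show "\<sigma> i = ?f (\<sigma> 1, \<sigma> (s + t)) i"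
        using \<sigma>X same[of i 1] same[of i "s + t"] st by (auto simp: PiE_iff extensional_def)
    qed
    moreover have "(\<sigma> 1, \<sigma> (s + t)) \<in> E \<inter> X \<times> X"
      using \<sigma>[of 1 "s + t"] \<sigma>X st by (auto simp: PiE_iff)
    ultimately show "\<sigma> \<in> ?f ` (E \<inter> X \<times> X)" by (rule image_eqI)
  qed
  have W: "(\<Prod>i\<in>?I. w (?f (u, v) i)) = w u ^ s * w v ^ t" for u v
  proof -
    have "(\<Prod>i\<in>?I. w (?f (u, v) i)) = (\<Prod>i\<in>{1..s}. w (?f (u, v) i)) * (\<Prod>i\<in>{s + 1..s + t}. w (?f (u, v) i))"
      unfolding I by (rule prod.union_disjoint) auto
    also have "(\<Prod>i\<in>{1..s}. w (?f (u, v) i)) = (\<Prod>i\<in>{1..s}. w u)"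
      by (rule prod.cong) auto
    also have "(\<Prod>i\<in>{s + 1..s + t}. w (?f (u, v) i)) = (\<Prod>i\<in>{s + 1..s + t}. w v)"
      by (rule prod.cong) auto
    finally show ?thesis by simp
  qed
  have fin: "finite (E \<inter> X \<times> X)" using X(1) by simp
  have pos: "0 \<le> (\<Prod>i\<in>?I. w (\<sigma> i))" if "\<sigma> \<in> ?f ` (E \<inter> X \<times> X)" for \<sigma>
    using that X(2) W by auto
  have "hom_weight ?K E w X \<le> (\<Sum>\<sigma>\<in>?f ` (E \<inter> X \<times> X). \<Prod>i\<in>?I. w (\<sigma> i))"
    unfolding hom_weight_def pverts_complete_bipartite
    using sub fin pos by (intro sum_mono2) auto
  also have "\<dots> \<le> (\<Sum>e\<in>E \<inter> X \<times> X. \<Prod>i\<in>?I. w (?f e i))"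
    using sum_image_le[OF fin, of "\<lambda>\<sigma>. \<Prod>i\<in>?I. w (\<sigma> i)" ?f] pos by (simp add: o_def)
  also have "\<dots> = (\<Sum>(u, v)\<in>E \<inter> X \<times> X. w u ^ s * w v ^ t)"
    using W by (intro sum.cong) auto
  also have "\<dots> = (\<Sum>(u, v)\<in>X \<times> X. arc_weight E s t w u v)"
    unfolding arc_weight_def using X(1)
    by (intro sum.mono_neutral_cong_left) (auto split: if_splits)
  also have "\<dots> = (\<Sum>u\<in>X. \<Sum>v\<in>X. arc_weight E s t w u v)"
    by (simp add: sum.cartesian_product)
  finally show ?thesis .
qed

lemma hom_weight_complete_bipartite_le:
  fixes w :: "'a \<Rightarrow> real"
  assumes "finite X" "\<And>x. x \<in> X \<Longrightarrow> 0 \<le> w x" "(\<Sum>x\<in>X. w x) = 1"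
    and asym: "\<And>x y. (x, y) \<in> E \<Longrightarrow> (y, x) \<notin> E" and st: "2 \<le> s" "s \<le> t"
  shows "hom_weight (complete_bipartite_digraph s t) E w X
    \<le> real s ^ s * real t ^ t / real (s + t) ^ (s + t)"
proof (rule hom_weight_le_if_le_on_tournaments[OF twin_closed_complete_bipartite])
  fix X and w :: "'a \<Rightarrow> real"
  assume X: "finite X" "\<And>x. x \<in> X \<Longrightarrow> 0 \<le> w x" "(\<Sum>x\<in>X. w x) = 1"
    "\<And>u v. u \<in> X \<Longrightarrow> v \<in> X \<Longrightarrow> u \<noteq> v \<Longrightarrow> (u, v) \<in> E \<or> (v, u) \<in> E"
  have "hom_weight (complete_bipartite_digraph s t) E w X
      \<le> (\<Sum>u\<in>X. \<Sum>v\<in>X. arc_weight E s t w u v)"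
    by (rule hom_weight_complete_bipartite_tournament) (use X st in auto)
  also have "\<dots> \<le> real s ^ s * real t ^ t / real (s + t) ^ (s + t)"
    by (rule sum_arc_weight_le) (use X asym st in auto)
  finally show "hom_weight (complete_bipartite_digraph s t) E w X
      \<le> real s ^ s * real t ^ t / real (s + t) ^ (s + t)" .
qed (use assms in auto)

section \<open>Counting induced copies\<close>

text \<open>
  An isomorphism of digraphs acts on arcs by a map of its own. For digraphs whose arcs are pairs,
  that map is determined by the action on vertices, so only the latter need be kept.
\<close>

lemma induced_iso_imp_strong_bij:
  assumes "digraph_iso (induce_subgraph (with_proj D) S) (with_proj K)"
  obtains h where "bij_betw h (pverts K) S"
    "\<And>i j. i \<in> pverts K \<Longrightarrow> j \<in> pverts K \<Longrightarrow> (h i, h j) \<in> parcs D \<longleftrightarrow> (i, j) \<in> parcs K"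
proof -
  let ?G = "induce_subgraph (with_proj D) S"
  obtain f where iso: "pre_digraph.digraph_isomorphism ?G f" and K: "with_proj K = app_iso f ?G"
    using assms unfolding digraph_iso_def by auto
  let ?g = "iso_verts f"
  have inj: "inj_on ?g S"
    using iso by (simp add: pre_digraph.digraph_isomorphism_def)
  have V: "pverts K = ?g ` S"
    using arg_cong[OF K, of verts] by simp
  have hd: "iso_tail f = fst" "iso_head f = snd"
    using arg_cong[OF K, of tail] arg_cong[OF K, of head] by simp_all
  have arc: "iso_arcs f (x, y) = (?g x, ?g y)" if "(x, y) \<in> parcs D" "x \<in> S" "y \<in> S" for x y
    using iso that by (fastforce simp: pre_digraph.digraph_isomorphism_def hd prod_eq_iff)
  have "parcs K = iso_arcs f ` {e \<in> parcs D. fst e \<in> S \<and> snd e \<in> S}"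
    using arg_cong[OF K, of arcs] by simp
  also have "\<dots> = (\<lambda>(x, y). (?g x, ?g y)) ` {e \<in> parcs D. fst e \<in> S \<and> snd e \<in> S}"
    using arc by (intro image_cong) auto
  finally have P: "parcs K = (\<lambda>(x, y). (?g x, ?g y)) ` {e \<in> parcs D. fst e \<in> S \<and> snd e \<in> S}" .
  let ?h = "the_inv_into S ?g"
  have "bij_betw ?h (pverts K) S"
    using inj V by (simp add: bij_betw_the_inv_into bij_betw_imageI)
  moreover have "(?h i, ?h j) \<in> parcs D \<longleftrightarrow> (i, j) \<in> parcs K" if ij: "i \<in> pverts K" "j \<in> pverts K" for i j
  proof -
    obtain x y where xy: "x \<in> S" "y \<in> S" "i = ?g x" "j = ?g y"
      using ij unfolding V by blast
    then show ?thesis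
      using inj by (auto simp: P the_inv_into_f_f image_iff inj_on_eq_iff)
  qed
  ultimately show thesis by (rule that)
qed

lemma strong_bij_imp_induced_iso:
  assumes h: "bij_betw h (pverts K) S" and K: "parcs K \<subseteq> pverts K \<times> pverts K"
    and arcs: "\<And>i j. i \<in> pverts K \<Longrightarrow> j \<in> pverts K \<Longrightarrow> (h i, h j) \<in> parcs D \<longleftrightarrow> (i, j) \<in> parcs K"
  shows "digraph_iso (induce_subgraph (with_proj D) S) (with_proj K)"
proof -
  let ?G = "induce_subgraph (with_proj D) S"
  let ?g = "the_inv_into (pverts K) h"
  let ?f = "\<lparr>iso_verts = ?g, iso_arcs = map_prod ?g ?g, iso_head = snd, iso_tail = fst\<rparr>"
  have inj: "inj_on h (pverts K)" and S: "S = h ` pverts K"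
    using h by (auto simp: bij_betw_def)
  have g: "inj_on ?g S" "?g ` S = pverts K"
    using bij_betw_the_inv_into[OF h] by (auto simp: bij_betw_def)
  have gh: "?g (h i) = i" if "i \<in> pverts K" for i
    using inj that by (rule the_inv_into_f_f)
  have "pre_digraph.digraph_isomorphism ?G ?f"
    unfolding pre_digraph.digraph_isomorphism_def
  proof (intro conjI)
    show "wf_digraph ?G" by unfold_locales auto
    show "inj_on (iso_verts ?f) (verts ?G)" using g by simp
    show "inj_on (iso_arcs ?f) (arcs ?G)"
      using g(1) by (auto simp: inj_on_def)
  qed auto
  moreover have "with_proj K = app_iso ?f ?G"
  proof -
    have "map_prod ?g ?g ` {e \<in> parcs D. fst e \<in> S \<and> snd e \<in> S} = parcs K"
    proof (intro equalityI subsetI)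
      fix e assume "e \<in> map_prod ?g ?g ` {e \<in> parcs D. fst e \<in> S \<and> snd e \<in> S}"
      then show "e \<in> parcs K" using arcs by (auto simp: S gh)
    next
      fix e assume "e \<in> parcs K"
      then obtain i j where e: "e = (i, j)" "(i, j) \<in> parcs K" "i \<in> pverts K" "j \<in> pverts K"
        using K by (cases e) auto
      then show "e \<in> map_prod ?g ?g ` {e \<in> parcs D. fst e \<in> S \<and> snd e \<in> S}"
        using arcs[of i j] by (intro image_eqI[of _ _ "(h i, h j)"]) (auto simp: gh S)
    qed
    then show ?thesis
      using g(2) by (simp add: with_proj_def app_iso_def)
  qed
  ultimately show ?thesis unfolding digraph_iso_def by blast
qed

definition automorphisms :: "'a pair_pre_digraph \<Rightarrow> ('a \<Rightarrow> 'a) set" where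
  "automorphisms K = {\<tau>. \<tau> permutes pverts K \<and>
     (\<forall>i\<in>pverts K. \<forall>j\<in>pverts K. (\<tau> i, \<tau> j) \<in> parcs K \<longleftrightarrow> (i, j) \<in> parcs K)}"

text \<open>
  Fix one parametrisation of each copy by \<open>K\<close> and precompose it with the automorphisms of \<open>K\<close>. The
  resulting maps are different: the image recovers the copy, and then injectivity of its
  parametrisation recovers the automorphism.
\<close>

lemma induced_copies_automorphisms_le:
  fixes K :: "'a pair_pre_digraph" and D :: "'b pair_pre_digraph"
  assumes fin: "finite (pverts K)" "finite (pverts D)"
  shows "induced_copies K D * card (automorphisms K) \<le> card (strong_homs K (parcs D) (pverts D))"
proof -
  let ?I = "pverts K"
  let ?C = "{S. S \<subseteq> pverts D \<and> card S = card ?I \<and> digraph_iso (induce_subgraph (with_proj D) S) (with_proj K)}"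
  have "\<forall>S\<in>?C. \<exists>h. bij_betw h ?I S \<and>
      (\<forall>i\<in>?I. \<forall>j\<in>?I. (h i, h j) \<in> parcs D \<longleftrightarrow> (i, j) \<in> parcs K)"
  proof
    fix S assume "S \<in> ?C"
    then have "digraph_iso (induce_subgraph (with_proj D) S) (with_proj K)" by simp
    then show "\<exists>h. bij_betw h ?I S \<and>
        (\<forall>i\<in>?I. \<forall>j\<in>?I. (h i, h j) \<in> parcs D \<longleftrightarrow> (i, j) \<in> parcs K)"
      by (rule induced_iso_imp_strong_bij) blast
  qed
  from bchoice[OF this] obtain h where "\<forall>S\<in>?C. bij_betw (h S) ?I S \<and>
      (\<forall>i\<in>?I. \<forall>j\<in>?I. (h S i, h S j) \<in> parcs D \<longleftrightarrow> (i, j) \<in> parcs K)"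
    by (rule exE)
  then have h: "bij_betw (h S) ?I S"
      "\<And>i j. i \<in> ?I \<Longrightarrow> j \<in> ?I \<Longrightarrow> (h S i, h S j) \<in> parcs D \<longleftrightarrow> (i, j) \<in> parcs K"
    if "S \<in> ?C" for S
    using that by blast+
  let ?f = "\<lambda>(S, \<tau>). restrict (h S \<circ> \<tau>) ?I"
  have "inj_on ?f (?C \<times> automorphisms K)"
  proof (rule inj_onI)
    fix e e' assume e: "e \<in> ?C \<times> automorphisms K" "e' \<in> ?C \<times> automorphisms K" "?f e = ?f e'"
    obtain S \<tau> S' \<tau>' where ee: "e = (S, \<tau>)" "e' = (S', \<tau>')" by (cases e, cases e')
    have eq: "restrict (h S \<circ> \<tau>) ?I = restrict (h S' \<circ> \<tau>') ?I"
      and C: "S \<in> ?C" "S' \<in> ?C" and \<tau>: "\<tau> \<in> automorphisms K" "\<tau>' \<in> automorphisms K"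
      using e by (simp_all add: ee)
    have p: "\<tau> permutes ?I" "\<tau>' permutes ?I" using \<tau> by (auto simp: automorphisms_def)
    have img: "restrict (h S \<circ> \<tau>) ?I ` ?I = S" if "S \<in> ?C" "\<tau> permutes ?I" for S \<tau>
    proof -
      have "restrict (h S \<circ> \<tau>) ?I ` ?I = h S ` (\<tau> ` ?I)" by (simp add: image_comp)
      then show ?thesis using h(1)[OF that(1)] permutes_image[OF that(2)] by (simp add: bij_betw_def)
    qed
    have S: "S = S'" using img[OF C(1) p(1)] img[OF C(2) p(2)] eq by simp
    have "\<tau> i = \<tau>' i" for i
    proof (cases "i \<in> ?I")
      case True
      then have "h S (\<tau> i) = h S (\<tau>' i)"
        using fun_cong[OF eq, of i] S by simp
      then show ?thesis
        using h(1)[OF C(1)] True p by (auto simp: bij_betw_def inj_on_eq_iff permutes_in_image)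
    qed (use p in \<open>simp add: permutes_not_in\<close>)
    then show "e = e'" using S by (auto simp: ee)
  qed
  moreover have "?f ` (?C \<times> automorphisms K) \<subseteq> strong_homs K (parcs D) (pverts D)"
  proof (rule image_subsetI)
    fix e assume e: "e \<in> ?C \<times> automorphisms K"
    obtain S \<tau> where ee: "e = (S, \<tau>)" by (cases e)
    have C: "S \<in> ?C" and \<tau>: "\<tau> \<in> automorphisms K" using e by (simp_all add: ee)
    have I: "\<tau> i \<in> ?I" if "i \<in> ?I" for i
      using \<tau> that by (simp add: automorphisms_def permutes_in_image)
    have "h S i \<in> pverts D" if "i \<in> ?I" for i
      using h(1)[OF C] C that by (auto simp: bij_betw_def)
    then show "?f e \<in> strong_homs K (parcs D) (pverts D)"
      using h(2)[OF C] \<tau> I by (auto simp: ee strong_homs_def automorphisms_def)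
  qed
  ultimately have "card (?C \<times> automorphisms K) \<le> card (strong_homs K (parcs D) (pverts D))"
    by (intro card_inj_on_le finite_strong_homs fin)
  then show ?thesis by (simp add: induced_copies_def card_cartesian_product)
qed

lemma card_automorphisms_complete_bipartite:
  "fact s * fact t \<le> card (automorphisms (complete_bipartite_digraph s t))"
proof -
  let ?K = "complete_bipartite_digraph s t"
  let ?A = "{1..s}" and ?B = "{s + 1..s + t}"
  let ?P = "{\<tau>. \<tau> permutes ?A} \<times> {\<tau>. \<tau> permutes ?B}"
  let ?f = "\<lambda>(\<tau>, \<tau>'). \<tau> \<circ> \<tau>'"
  \<comment> \<open>The two permutations have disjoint supports.\<close>
  have val: "(\<tau> \<circ> \<tau>') i = (if i \<in> ?B then \<tau>' i else \<tau> i)"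
    if "\<tau> permutes ?A" "\<tau>' permutes ?B" for \<tau> \<tau>' i
  proof (cases "i \<in> ?B")
    case True
    then have "\<tau>' i \<in> ?B" using that by (simp add: permutes_in_image del: atLeastAtMost_iff)
    then have "\<tau>' i \<notin> ?A" by auto
    then show ?thesis using that(1) True by (simp add: permutes_not_in del: atLeastAtMost_iff)
  next
    case False
    then show ?thesis using that(2) by (simp add: permutes_not_in del: atLeastAtMost_iff)
  qed
  have "inj_on ?f ?P"
  proof (rule inj_onI, clarify)
    fix \<tau> \<tau>' \<pi> \<pi>'
    assume p: "\<tau> permutes ?A" "\<pi> permutes ?A" "\<tau>' permutes ?B" "\<pi>' permutes ?B" and eq: "\<tau> \<circ> \<tau>' = \<pi> \<circ> \<pi>'"
    have "\<tau> i = \<pi> i" for i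
      using fun_cong[OF eq, of i] val[OF p(1,3), of i] val[OF p(2,4), of i]
        permutes_not_in[OF p(1), of i] permutes_not_in[OF p(2), of i]
      by (cases "i \<in> ?B") auto
    moreover have "\<tau>' i = \<pi>' i" for i
      using fun_cong[OF eq, of i] val[OF p(1,3), of i] val[OF p(2,4), of i]
        permutes_not_in[OF p(3), of i] permutes_not_in[OF p(4), of i]
      by (cases "i \<in> ?B") auto
    ultimately show "\<tau> = \<pi> \<and> \<tau>' = \<pi>'" by auto
  qed
  moreover have "?f ` ?P \<subseteq> automorphisms ?K"
  proof clarify
    fix \<tau> \<tau>' assume p: "\<tau> permutes ?A" "\<tau>' permutes ?B"
    have "\<tau> permutes pverts ?K" "\<tau>' permutes pverts ?K"
      using p by (auto intro: permutes_subset)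
    then have "(\<tau> \<circ> \<tau>') permutes pverts ?K" by (intro permutes_compose)
    moreover have "(\<tau> \<circ> \<tau>') i \<in> ?A \<longleftrightarrow> i \<in> ?A" "(\<tau> \<circ> \<tau>') i \<in> ?B \<longleftrightarrow> i \<in> ?B" for i
    proof -
      have a: "\<tau> i \<in> ?A \<longleftrightarrow> i \<in> ?A" and b: "\<tau>' i \<in> ?B \<longleftrightarrow> i \<in> ?B"
        using p by (simp_all only: permutes_in_image)
      have c: "i \<notin> ?A \<Longrightarrow> \<tau> i = i" using p(1) by (rule permutes_not_in)
      show "(\<tau> \<circ> \<tau>') i \<in> ?A \<longleftrightarrow> i \<in> ?A" "(\<tau> \<circ> \<tau>') i \<in> ?B \<longleftrightarrow> i \<in> ?B"
        unfolding val[OF p] using a b c by auto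
    qed
    ultimately show "\<tau> \<circ> \<tau>' \<in> automorphisms ?K"
      by (simp only: automorphisms_def mem_Collect_eq parcs_complete_bipartite) blast
  qed
  moreover have "finite (automorphisms ?K)"
    by (rule finite_subset[OF _ finite_permutations[of "pverts ?K"]]) (auto simp: automorphisms_def)
  ultimately have "card ?P \<le> card (automorphisms ?K)"
    by (rule card_inj_on_le)
  then show ?thesis by (simp add: card_cartesian_product card_permutations)
qed

text \<open>
  Evaluate the polynomial at the uniform weights, where it is the number of strong homomorphisms
  divided by the number of all maps.
\<close>

lemma induced_copies_complete_bipartite_le:
  fixes D :: "'b pair_pre_digraph"
  assumes D: "pair_oriented_digraph D" "pverts D \<noteq> {}" and st: "2 \<le> s" "s \<le> t"
  shows "real (induced_copies (complete_bipartite_digraph s t) D)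
    \<le> real s ^ s * real t ^ t / real (s + t) ^ (s + t) / (fact s * fact t) * real (card (pverts D)) ^ (s + t)"
proof -
  let ?K = "complete_bipartite_digraph s t" and ?n = "card (pverts D)"
  interpret pair_oriented_digraph D by (fact D(1))
  have n: "0 < ?n" using D(2) pair_finite_verts by (simp add: card_gt_0_iff)
  have "induced_copies ?K D * (fact s * fact t) \<le> induced_copies ?K D * card (automorphisms ?K)"
    by (intro mult_left_mono card_automorphisms_complete_bipartite) auto
  also have "\<dots> \<le> card (strong_homs ?K (parcs D) (pverts D))"
    using pair_finite_verts by (intro induced_copies_automorphisms_le) auto
  finally have "real (induced_copies ?K D * (fact s * fact t)) \<le> real (card (strong_homs ?K (parcs D) (pverts D)))"
    by (simp only: of_nat_le_iff)
  also have "\<dots> = hom_weight ?K (parcs D) (\<lambda>_. 1 / real ?n) (pverts D) * real ?n ^ (s + t)"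
    using n D(2) by (simp add: hom_weight_def power_divide)
  also have "\<dots> \<le> real s ^ s * real t ^ t / real (s + t) ^ (s + t) * real ?n ^ (s + t)"
    using n pair_finite_verts no_opposite_arcs st
    by (intro mult_right_mono hom_weight_complete_bipartite_le) auto
  finally have "real (induced_copies ?K D) * (fact s * fact t)
      \<le> real s ^ s * real t ^ t / real (s + t) ^ (s + t) * real ?n ^ (s + t)"
    by (simp only: of_nat_mult of_nat_fact)
  then have "real (induced_copies ?K D)
      \<le> real s ^ s * real t ^ t / real (s + t) ^ (s + t) * real ?n ^ (s + t) / (fact s * fact t)"
    by (subst pos_le_divide_eq) auto
  then show ?thesis by (simp only: times_divide_eq_left)
qed

lemma induced_copies_in_complete_bipartite_ge:
  "(a choose s) * (b choose t) \<le> induced_copies (complete_bipartite_digraph s t) (complete_bipartite_digraph a b)"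
proof -
  let ?K = "complete_bipartite_digraph s t" and ?D = "complete_bipartite_digraph a b"
  let ?P = "{A. A \<subseteq> {1..a} \<and> card A = s} \<times> {B. B \<subseteq> {a + 1..a + b} \<and> card B = t}"
  let ?C = "{S. S \<subseteq> pverts ?D \<and> card S = card (pverts ?K) \<and> digraph_iso (induce_subgraph (with_proj ?D) S) (with_proj ?K)}"
  have "inj_on (\<lambda>(A, B). A \<union> B) ?P"
  proof (rule inj_onI, clarify)
    fix A B A' B' :: "nat set"
    assume "A \<subseteq> {1..a}" "A' \<subseteq> {1..a}" "B \<subseteq> {a + 1..a + b}" "B' \<subseteq> {a + 1..a + b}" and eq: "A \<union> B = A' \<union> B'"
    then have "A = (A \<union> B) \<inter> {1..a}" "A' = (A' \<union> B') \<inter> {1..a}"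
      "B = (A \<union> B) \<inter> {a + 1..a + b}" "B' = (A' \<union> B') \<inter> {a + 1..a + b}"
      by fastforce+
    then show "A = A' \<and> B = B'" using eq by metis
  qed
  moreover have "(\<lambda>(A, B). A \<union> B) ` ?P \<subseteq> ?C"
  proof (rule image_subsetI)
    fix p assume "p \<in> ?P"
    then obtain A B where p: "p = (A, B)"
      and A: "A \<subseteq> {1..a}" "card A = s" and B: "B \<subseteq> {a + 1..a + b}" "card B = t"
      by auto
    have fin: "finite A" "finite B" using A B by (auto intro: finite_subset)
    have disj: "A \<inter> B = {}" using A B by fastforce
    obtain g where g: "bij_betw g {1..s} A"
      using finite_same_card_bij[of "{1..s}" A] fin A by auto
    obtain g' where g': "bij_betw g' {s + 1..s + t} B"
      using finite_same_card_bij[of "{s + 1..s + t}" B] fin B by auto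
    let ?h = "\<lambda>i. if i \<in> {1..s} then g i else g' i"
    have "bij_betw ?h ({1..s} \<union> {s + 1..s + t}) (A \<union> B)"
      using g g' disj by (intro bij_betw_disjoint_Un) auto
    also have "{1..s} \<union> {s + 1..s + t} = pverts ?K" by auto
    finally have bij: "bij_betw ?h (pverts ?K) (A \<union> B)" .
    have hA: "?h i \<in> {1..a} \<and> ?h i \<notin> {a + 1..a + b}" if "i \<in> {1..s}" for i
      using bij_betwE[OF g] that A by fastforce
    have hB: "?h i \<notin> {1..a} \<and> ?h i \<in> {a + 1..a + b}" if "i \<in> {s + 1..s + t}" for i
      using bij_betwE[OF g'] that B by fastforce
    have K: "i \<in> {1..s} \<or> i \<in> {s + 1..s + t} \<and> i \<notin> {1..s}" if "i \<in> pverts ?K" for i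
      using that by auto
    have "digraph_iso (induce_subgraph (with_proj ?D) (A \<union> B)) (with_proj ?K)"
    proof (rule strong_bij_imp_induced_iso[OF bij])
      fix i j assume "i \<in> pverts ?K" "j \<in> pverts ?K"
      then show "(?h i, ?h j) \<in> parcs ?D \<longleftrightarrow> (i, j) \<in> parcs ?K"
        using K[of i] K[of j] hA[of i] hA[of j] hB[of i] hB[of j]
        unfolding parcs_complete_bipartite by metis
    qed auto
    moreover have "card (A \<union> B) = card (pverts ?K)"
      using fin disj A B by (simp add: card_Un_disjoint)
    moreover have "A \<union> B \<subseteq> pverts ?D" using A B by fastforce
    ultimately show "(\<lambda>(A, B). A \<union> B) p \<in> ?C" unfolding p by simp
  qed
  moreover have "finite ?C" by (rule finite_subset[of _ "Pow (pverts ?D)"]) auto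
  ultimately have "card ?P \<le> card ?C" by (rule card_inj_on_le)
  then show ?thesis
    by (simp add: induced_copies_def card_cartesian_product n_subsets)
qed

section \<open>Asymptotics\<close>

lemma tendsto_binomial_over_power:
  assumes "(\<lambda>n. real (m n) / real n) \<longlonglongrightarrow> p"
  shows "(\<lambda>n. real (m n choose k) / real n ^ k) \<longlonglongrightarrow> p ^ k / fact k"
proof -
  have "real (m n choose k) / real n ^ k = (\<Prod>i = 0..<k. real (m n) / real n - real i / real n) / fact k" for n
    by (simp add: binomial_gbinomial gbinomial_prod_rev prod_dividef flip: diff_divide_distrib)
  moreover have "(\<lambda>n. (\<Prod>i = 0..<k. real (m n) / real n - real i / real n) / fact k)
      \<longlonglongrightarrow> (\<Prod>i = 0..<k. p - 0) / fact k"
    by (intro tendsto_intros assms lim_const_over_n) auto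
  ultimately show ?thesis by simp
qed

lemma tendsto_part_ratio:
  fixes m :: "nat \<Rightarrow> nat"
  assumes "\<And>n. int (m n) \<in> {\<lfloor>p * real n\<rfloor>, \<lceil>p * real n\<rceil>}"
  shows "(\<lambda>n. real (m n) / real n) \<longlonglongrightarrow> p"
proof (rule LIM_zero_cancel, rule tendsto_rabs_zero_cancel,
    rule tendsto_sandwich[where f = "\<lambda>_. 0" and h = "\<lambda>n. 1 / real n"])
  show "\<forall>\<^sub>F n in sequentially. \<bar>real (m n) / real n - p\<bar> \<le> 1 / real n"
    using eventually_gt_at_top[of 0]
  proof eventually_elim
    case (elim n)
    have "\<bar>real_of_int (int (m n)) - p * real n\<bar> \<le> 1"
      using assms[of n] by (auto simp only: insert_iff empty_iff) linarith+
    moreover have "real (m n) / real n - p = (real (m n) - p * real n) / real n"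
      using elim by (simp add: field_simps)
    ultimately show ?case using elim by (simp add: divide_right_mono)
  qed
qed (use lim_1_over_n in auto)

lemma part_size_le:
  fixes m :: nat
  assumes "int m \<in> {\<lfloor>p * real n\<rfloor>, \<lceil>p * real n\<rceil>}" "p \<le> 1"
  shows "m \<le> n"
proof -
  have "p * real n \<le> real n" using assms(2) by (simp add: mult_left_le_one_le mult_right_mono[of p 1, simplified])
  then have "\<lceil>p * real n\<rceil> \<le> int n" "\<lfloor>p * real n\<rfloor> \<le> int n" by linarith+
  then show ?thesis using assms(1) by auto
qed

lemma binomial_power_eq_fact:
  "real ((s + t) choose s) * (real s / real (s + t)) ^ s * (real t / real (s + t)) ^ t
    = real s ^ s * real t ^ t / real (s + t) ^ (s + t) / (fact s * fact t) * fact (s + t)"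
  by (simp add: binomial_fact power_divide power_add mult_ac)

lemma induced_density_complete_bipartite_le:
  fixes D :: "'b pair_pre_digraph"
  assumes "pair_oriented_digraph D" "card (pverts D) = n" "0 < n" "2 \<le> s" "s \<le> t"
  shows "induced_density (complete_bipartite_digraph s t) D
    \<le> real s ^ s * real t ^ t / real (s + t) ^ (s + t) / (fact s * fact t)
      / (real (n choose (s + t)) / real n ^ (s + t))"
proof -
  have "pverts D \<noteq> {}" using assms by auto
  from induced_copies_complete_bipartite_le[OF assms(1) this assms(4,5)]
  have "induced_density (complete_bipartite_digraph s t) D
      \<le> real s ^ s * real t ^ t / real (s + t) ^ (s + t) / (fact s * fact t) * real n ^ (s + t)
        / real (n choose (s + t))"
    unfolding induced_density_def assms(2) pverts_complete_bipartite
    by (simp only: card_atLeastAtMost divide_right_mono of_nat_0_le_iff Suc_eq_plus1 add_diff_cancel_right')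
  then show ?thesis by simp
qed

lemma tendsto_density_upper_bound:
  fixes c :: real
  shows "(\<lambda>n. c / (real (n choose k) / real n ^ k)) \<longlonglongrightarrow> c * fact k"
proof -
  have "(\<lambda>n. real n / real n) \<longlonglongrightarrow> 1"
    by (rule tendsto_eventually) (use eventually_gt_at_top[of 0] in eventually_elim, simp)
  from tendsto_binomial_over_power[OF this]
  have lim: "(\<lambda>n. real (n choose k) / real n ^ k) \<longlonglongrightarrow> 1 / fact k" by simp
  have "(\<lambda>n. c / (real (n choose k) / real n ^ k)) \<longlonglongrightarrow> c / (1 / fact k)"
    by (rule tendsto_divide[OF tendsto_const lim]) simp
  then show ?thesis by simp
qed

text \<open>
  The lower estimate counts copies with one part inside each part; the upper estimate is the one
  valid for all digraphs. Both have the same limit, so no exact count is needed.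
\<close>

lemma tendsto_density_in_complete_bipartite:
  fixes a :: "nat \<Rightarrow> nat"
  assumes st: "2 \<le> s" "s \<le> t"
    and a: "\<And>n. int (a n) \<in> {\<lfloor>real s / real (s + t) * real n\<rfloor>, \<lceil>real s / real (s + t) * real n\<rceil>}"
  shows "(\<lambda>n. induced_density (complete_bipartite_digraph s t) (complete_bipartite_digraph (a n) (n - a n)))
    \<longlonglongrightarrow> real ((s + t) choose s) * (real s / real (s + t)) ^ s * (real t / real (s + t)) ^ t"
    (is "?d \<longlonglongrightarrow> ?L")
proof -
  let ?p = "real s / real (s + t)" and ?q = "real t / real (s + t)"
  let ?M = "real s ^ s * real t ^ t / real (s + t) ^ (s + t) / (fact s * fact t)"
  let ?u = "\<lambda>n. ?M / (real (n choose (s + t)) / real n ^ (s + t))"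
  let ?l = "\<lambda>n. (real (a n choose s) / real n ^ s) * (real ((n - a n) choose t) / real n ^ t)
    / (real (n choose (s + t)) / real n ^ (s + t))"
  have an: "a n \<le> n" for n by (rule part_size_le[OF a]) (simp add: divide_le_eq)
  have card: "card (pverts (complete_bipartite_digraph (a n) (n - a n))) = n" for n
    using an[of n] by simp
  have upper: "\<forall>\<^sub>F n in sequentially. ?d n \<le> ?u n"
    using eventually_gt_at_top[of 0]
    by eventually_elim
      (rule induced_density_complete_bipartite_le[OF pair_oriented_complete_bipartite_digraph card _ st])
  have lim_upper: "?u \<longlonglongrightarrow> ?L"
    unfolding binomial_power_eq_fact by (rule tendsto_density_upper_bound)
  have lower: "\<forall>\<^sub>F n in sequentially. ?l n \<le> ?d n"
    using eventually_gt_at_top[of 0]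
  proof eventually_elim
    case (elim n)
    have "real ((a n choose s) * ((n - a n) choose t))
        \<le> real (induced_copies (complete_bipartite_digraph s t) (complete_bipartite_digraph (a n) (n - a n)))"
      by (simp only: of_nat_le_iff induced_copies_in_complete_bipartite_ge)
    then have "real ((a n choose s) * ((n - a n) choose t)) / real (n choose (s + t)) \<le> ?d n"
      unfolding induced_density_def card by (simp add: divide_right_mono)
    then show ?case using elim by (simp add: power_add)
  qed
  have pq: "1 - ?p = ?q" using st by (simp add: field_simps)
  have A: "(\<lambda>n. real (a n) / real n) \<longlonglongrightarrow> ?p" by (rule tendsto_part_ratio[OF a])
  have "(\<lambda>n. 1 - real (a n) / real n) \<longlonglongrightarrow> 1 - ?p"
    by (intro tendsto_intros A)
  moreover have "\<forall>\<^sub>F n in sequentially. 1 - real (a n) / real n = real (n - a n) / real n"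
    using eventually_gt_at_top[of 0]
    by eventually_elim (use an in \<open>simp add: of_nat_diff diff_divide_distrib\<close>)
  ultimately have B: "(\<lambda>n. real (n - a n) / real n) \<longlonglongrightarrow> ?q"
    using pq by (simp add: tendsto_cong)
  have "(\<lambda>n. (real (a n choose s) / real n ^ s) * (real ((n - a n) choose t) / real n ^ t)
        * (1 / (real (n choose (s + t)) / real n ^ (s + t))))
      \<longlonglongrightarrow> (?p ^ s / fact s) * (?q ^ t / fact t) * (1 * fact (s + t))"
    by (intro tendsto_mult tendsto_binomial_over_power A B tendsto_density_upper_bound)
  also have "(?p ^ s / fact s) * (?q ^ t / fact t) * (1 * fact (s + t)) = ?L"
    unfolding binomial_power_eq_fact by (simp add: power_divide power_add)
  finally have "?l \<longlonglongrightarrow> ?L" by simp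
  then show ?thesis by (rule tendsto_sandwich[OF lower upper _ lim_upper])
qed

theorem theorem3p1:
  fixes s t :: nat
  assumes "2 \<le> s" and "s \<le> t"
  shows "max_induced_density (complete_bipartite_digraph s t)
             \<longlonglongrightarrow> inducibility (complete_bipartite_digraph s t) \<and>
         inducibility (complete_bipartite_digraph s t)
           = real ((s + t) choose s) * (real s / real (s + t)) ^ s * (real t / real (s + t)) ^ t \<and>
         (\<forall>a :: nat \<Rightarrow> nat.
           (\<forall>n. int (a n) \<in> {\<lfloor>real s / real (s + t) * real n\<rfloor>, \<lceil>real s / real (s + t) * real n\<rceil>}) \<longrightarrow>
           (\<lambda>n. induced_density (complete_bipartite_digraph s t)
                   (complete_bipartite_digraph (a n) (n - a n)))
             \<longlonglongrightarrow> inducibility (complete_bipartite_digraph s t))"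
proof -
  let ?K = "complete_bipartite_digraph s t"
  let ?L = "real ((s + t) choose s) * (real s / real (s + t)) ^ s * (real t / real (s + t)) ^ t"
  let ?M = "real s ^ s * real t ^ t / real (s + t) ^ (s + t) / (fact s * fact t)"
  let ?a = "\<lambda>n. nat \<lfloor>real s / real (s + t) * real n\<rfloor>"
  let ?d = "\<lambda>n. induced_density ?K (complete_bipartite_digraph (?a n) (n - ?a n))"
  have a: "int (?a n) \<in> {\<lfloor>real s / real (s + t) * real n\<rfloor>, \<lceil>real s / real (s + t) * real n\<rceil>}" for n
    by simp
  have an: "?a n \<le> n" for n by (rule part_size_le[OF a]) (simp add: divide_le_eq)
  have lim: "max_induced_density ?K \<longlonglongrightarrow> ?L"
  proof (rule tendsto_sandwich)
    show "?d \<longlonglongrightarrow> ?L" by (rule tendsto_density_in_complete_bipartite[OF assms a])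
    show "(\<lambda>n. ?M / (real (n choose (s + t)) / real n ^ (s + t))) \<longlonglongrightarrow> ?L"
      unfolding binomial_power_eq_fact by (rule tendsto_density_upper_bound)
    show "\<forall>\<^sub>F n in sequentially. ?d n \<le> max_induced_density ?K n"
    proof (rule always_eventually, rule allI)
      fix n
      have "card (pverts (complete_bipartite_digraph (?a n) (n - ?a n))) = n"
        using an[of n] by simp
      then have "?d n \<in> {induced_density ?K D | D :: nat pair_pre_digraph.
          pair_oriented_digraph D \<and> card (pverts D) = n}"
        using pair_oriented_complete_bipartite_digraph by blast
      then show "?d n \<le> max_induced_density ?K n"
        unfolding max_induced_density_def by (rule Max_ge[OF finite_induced_densities])
    qed
    show "\<forall>\<^sub>F n in sequentially. max_induced_density ?K n
        \<le> ?M / (real (n choose (s + t)) / real n ^ (s + t))"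
      using eventually_gt_at_top[of 0]
    proof eventually_elim
      case (elim n)
      have "max_induced_density ?K n \<in> {induced_density ?K D | D :: nat pair_pre_digraph.
          pair_oriented_digraph D \<and> card (pverts D) = n}"
        unfolding max_induced_density_def
        by (rule Max_in[OF finite_induced_densities induced_densities_nonempty])
      then obtain D :: "nat pair_pre_digraph" where
        D: "max_induced_density ?K n = induced_density ?K D" "pair_oriented_digraph D" "card (pverts D) = n"
        by blast
      show ?case unfolding D(1) by (rule induced_density_complete_bipartite_le[OF D(2,3) elim assms])
    qed
  qed
  then have "inducibility ?K = ?L" unfolding inducibility_def by (rule limI)
  then show ?thesis
    using lim tendsto_density_in_complete_bipartite[OF assms] by simp
qed

end
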